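(* Let $n\ge4$, let $\alpha_3,\dots,\alpha_{n-1}\in\mathbb{C}$, and let $\varphi$ be a $\frac12$-derivation of the Lie algebra $\mathfrak{s}^{4}_{n,1}(\alpha_3,\alpha_4,\dots,\alpha_{n-1})$. Then there are complex numbers $a_1,a_3,\dots,a_n,c_n$ such that $$\varphi(e_1)=a_1e_1+\sum_{i=3}^na_ie_i,\quad \varphi(e_i)=a_1e_i\ (2\le i\le n),$$ $$\varphi(x)=\sum_{i=2}^{n-1}\Big(a_{i+1}+\sum_{t=3}^{i-1}\alpha_ta_{i-t+2}\Big)e_i+c_ne_n+a_1x.$$
   Context: All algebras are over $\mathbb{C}$; empty sums are zero. A $\frac12$-derivation of a Lie algebra $(\mathfrak{L},[-,-])$ is a linear map $\varphi:\mathfrak{L}\to\mathfrak{L}$ with $\varphi([u,v])=\frac12([\varphi(u),v]+[u,\varphi(v)])$ for all $u,v\in\mathfrak{L}$. $\mathfrak{s}^{4}_{n,1}(\alpha_3,\dots,\alpha_{n-1})$ is the $(n+1)$-dimensional Lie algebra with basis $e_1,\dots,e_n,x$ and brackets $[e_i,e_1]=e_{i+1}$ for $2\le i\le n-1$; $[e_i,x]=e_i+\sum_{l=i+2}^{n}\alpha_{l+1-i}e_l$ for $2\le i\le n$; brackets of basis elements not determined by these and antisymmetry are zero. *)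

theory Defs
  imports "HOL-Analysis.Analysis"
begin

locale complex_lie_algebra = vector_space smul
  for smul :: "complex \<Rightarrow> 'v::ab_group_add \<Rightarrow> 'v" (infixr \<open>*\<^sub>C\<close> 75) +
  fixes bracket :: "'v \<Rightarrow> 'v \<Rightarrow> 'v" (\<open>[_, _]\<^sub>L\<close>)
  assumes bracket_add_left: "[u + v, w]\<^sub>L = [u, w]\<^sub>L + [v, w]\<^sub>L"
    and bracket_add_right: "[u, v + w]\<^sub>L = [u, v]\<^sub>L + [u, w]\<^sub>L"
    and bracket_scale_left: "[c *\<^sub>C u, v]\<^sub>L = c *\<^sub>C [u, v]\<^sub>L"
    and bracket_scale_right: "[u, c *\<^sub>C v]\<^sub>L = c *\<^sub>C [u, v]\<^sub>L"
    and bracket_self: "[u, u]\<^sub>L = 0"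
    and jacobi: "[u, [v, w]\<^sub>L]\<^sub>L + [v, [w, u]\<^sub>L]\<^sub>L + [w, [u, v]\<^sub>L]\<^sub>L = 0"

definition half_derivation ::
  "(complex \<Rightarrow> 'v::ab_group_add \<Rightarrow> 'v) \<Rightarrow> ('v \<Rightarrow> 'v \<Rightarrow> 'v) \<Rightarrow> ('v \<Rightarrow> 'v) \<Rightarrow> bool" where
  "half_derivation smul bracket \<phi> \<longleftrightarrow>
     Vector_Spaces.linear smul smul \<phi> \<and>
     (\<forall>u v. \<phi> (bracket u v) = smul (1/2) (bracket (\<phi> u) v + bracket u (\<phi> v)))"

text \<open>
  The whole type is the Lie algebra, with the indexed basis \<open>e 1, \<dots>, e n, x\<close>; the dimension of
  the type is therefore \<open>n + 1\<close>. Values of \<open>e\<close> outside \<open>{1..n}\<close> and of \<open>\<alpha>\<close> outside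
  \<open>{3..n - 1}\<close> are irrelevant. The last three brackets below are the ones that are zero because
  they are not listed; all remaining ones follow by antisymmetry.
\<close>
locale s4_algebra = complex_lie_algebra smul bracket
  for smul :: "complex \<Rightarrow> 'v::ab_group_add \<Rightarrow> 'v" (infixr \<open>*\<^sub>C\<close> 75)
    and bracket :: "'v \<Rightarrow> 'v \<Rightarrow> 'v" (\<open>[_, _]\<^sub>L\<close>) +
  fixes n :: nat and \<alpha> :: "nat \<Rightarrow> complex" and e :: "nat \<Rightarrow> 'v" and x :: 'v
  assumes basis_inj: "inj_on e {1..n}"
    and basis_x: "x \<notin> e ` {1..n}"
    and basis_independent: "independent (insert x (e ` {1..n}))"
    and basis_span: "span (insert x (e ` {1..n})) = UNIV"
    and bracket_e_e1: "i \<in> {2..n-1} \<Longrightarrow> [e i, e 1]\<^sub>L = e (i + 1)"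
    and bracket_e_x: "i \<in> {2..n} \<Longrightarrow>
      [e i, x]\<^sub>L = e i + (\<Sum>l = i+2..n. \<alpha> (l + 1 - i) *\<^sub>C e l)"
    and bracket_en_e1: "[e n, e 1]\<^sub>L = 0"
    and bracket_e1_x: "[e 1, x]\<^sub>L = 0"
    and bracket_e_e: "i \<in> {2..n} \<Longrightarrow> j \<in> {2..n} \<Longrightarrow> [e i, e j]\<^sub>L = 0"

text \<open>
  The algebra exists for all parameters: a model on \<open>complex ^ 'm\<close> whenever \<open>CARD('m) = n + 1\<close>.
  In the coordinates \<open>p 0\<close> (of \<open>x\<close>) and \<open>p i\<close> (of \<open>e i\<close>), \<open>s4_ad_e1\<close> and \<open>s4_ad_x\<close> are the
  maps \<open>[\<cdot>, e 1]\<close> and \<open>[\<cdot>, x]\<close> on the span of \<open>e 2, \<dots>, e n\<close>.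
\<close>
definition s4_ad_e1 :: "(nat \<Rightarrow> complex) \<Rightarrow> nat \<Rightarrow> complex" where
  "s4_ad_e1 p k = (if 3 \<le> k then p (k - 1) else 0)"

definition s4_ad_x :: "(nat \<Rightarrow> complex) \<Rightarrow> (nat \<Rightarrow> complex) \<Rightarrow> nat \<Rightarrow> complex" where
  "s4_ad_x \<alpha> p k = (if 2 \<le> k then p k + (\<Sum>j = 2..<k-1. \<alpha> (k + 1 - j) * p j) else 0)"

definition s4_coord_bracket ::
  "(nat \<Rightarrow> complex) \<Rightarrow> (nat \<Rightarrow> complex) \<Rightarrow> (nat \<Rightarrow> complex) \<Rightarrow> nat \<Rightarrow> complex" where
  "s4_coord_bracket \<alpha> p q k =
     q 1 * s4_ad_e1 p k + q 0 * s4_ad_x \<alpha> p k - p 1 * s4_ad_e1 q k - p 0 * s4_ad_x \<alpha> q k"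

lemma s4_ad_cong:
  assumes "\<And>j. j \<le> k \<Longrightarrow> p j = q j"
  shows "s4_ad_e1 p k = s4_ad_e1 q k" "s4_ad_x \<alpha> p k = s4_ad_x \<alpha> q k"
  using assms unfolding s4_ad_e1_def s4_ad_x_def
  by (auto intro!: sum.cong)

lemma s4_ad_commute: "s4_ad_e1 (s4_ad_x \<alpha> p) k = s4_ad_x \<alpha> (s4_ad_e1 p) k"
proof (cases "3 \<le> k")
  case True
  have "(\<Sum>j = 2..<k-1. \<alpha> (k + 1 - j) * s4_ad_e1 p j)
      = (\<Sum>j = 3..<k-1. \<alpha> (k + 1 - j) * s4_ad_e1 p j)"
    by (rule sum.mono_neutral_right) (auto simp: s4_ad_e1_def)
  also have "\<dots> = (\<Sum>j = 2..<k-2. \<alpha> (k - j) * p j)"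
    by (rule sum.reindex_bij_witness[of _ Suc "\<lambda>j. j - 1"]) (auto simp: s4_ad_e1_def)
  finally show ?thesis
    using True by (auto simp: s4_ad_e1_def s4_ad_x_def numeral_2_eq_2 Suc_diff_le)
next
  case False
  have "(\<Sum>j = 2..<k-1. \<alpha> (k + 1 - j) * s4_ad_e1 p j) = 0"
    using False by (intro sum.neutral) (auto simp: s4_ad_e1_def)
  with False show ?thesis by (auto simp: s4_ad_e1_def s4_ad_x_def)
qed

lemma s4_ad_add:
  "s4_ad_e1 (\<lambda>i. p i + q i) k = s4_ad_e1 p k + s4_ad_e1 q k"
  "s4_ad_x \<alpha> (\<lambda>i. p i + q i) k = s4_ad_x \<alpha> p k + s4_ad_x \<alpha> q k"
  by (auto simp: s4_ad_e1_def s4_ad_x_def sum.distrib algebra_simps)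

lemma s4_ad_diff:
  "s4_ad_e1 (\<lambda>i. p i - q i) k = s4_ad_e1 p k - s4_ad_e1 q k"
  "s4_ad_x \<alpha> (\<lambda>i. p i - q i) k = s4_ad_x \<alpha> p k - s4_ad_x \<alpha> q k"
  by (auto simp: s4_ad_e1_def s4_ad_x_def sum_subtractf algebra_simps)

lemma s4_ad_scale:
  "s4_ad_e1 (\<lambda>i. c * p i) k = c * s4_ad_e1 p k"
  "s4_ad_x \<alpha> (\<lambda>i. c * p i) k = c * s4_ad_x \<alpha> p k"
  by (auto simp: s4_ad_e1_def s4_ad_x_def sum_distrib_left algebra_simps)

lemma s4_coord_bracket_low: "k < 2 \<Longrightarrow> s4_coord_bracket \<alpha> p q k = 0"
  by (simp add: s4_coord_bracket_def s4_ad_e1_def s4_ad_x_def)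

lemma s4_coord_bracket_nested:
  "s4_coord_bracket \<alpha> p (s4_coord_bracket \<alpha> q r) k =
     - p 1 * (r 1 * s4_ad_e1 (s4_ad_e1 q) k + r 0 * s4_ad_e1 (s4_ad_x \<alpha> q) k
              - q 1 * s4_ad_e1 (s4_ad_e1 r) k - q 0 * s4_ad_e1 (s4_ad_x \<alpha> r) k)
     - p 0 * (r 1 * s4_ad_x \<alpha> (s4_ad_e1 q) k + r 0 * s4_ad_x \<alpha> (s4_ad_x \<alpha> q) k
              - q 1 * s4_ad_x \<alpha> (s4_ad_e1 r) k - q 0 * s4_ad_x \<alpha> (s4_ad_x \<alpha> r) k)"
proof -
  have *: "s4_coord_bracket \<alpha> q r = (\<lambda>i. r 1 * s4_ad_e1 q i + r 0 * s4_ad_x \<alpha> q i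
      - q 1 * s4_ad_e1 r i - q 0 * s4_ad_x \<alpha> r i)"
    by (rule ext) (simp add: s4_coord_bracket_def)
  have "s4_coord_bracket \<alpha> q r 0 = 0" "s4_coord_bracket \<alpha> q r 1 = 0"
    by (simp_all add: s4_coord_bracket_low)
  then have "s4_coord_bracket \<alpha> p (s4_coord_bracket \<alpha> q r) k =
      - p 1 * s4_ad_e1 (s4_coord_bracket \<alpha> q r) k - p 0 * s4_ad_x \<alpha> (s4_coord_bracket \<alpha> q r) k"
    by (simp add: s4_coord_bracket_def[of \<alpha> p])
  then show ?thesis
    unfolding * by (simp only: s4_ad_add s4_ad_diff s4_ad_scale)
qed

lemma s4_coord_bracket_jacobi:
  "s4_coord_bracket \<alpha> p (s4_coord_bracket \<alpha> q r) k + s4_coord_bracket \<alpha> q (s4_coord_bracket \<alpha> r p) k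
     + s4_coord_bracket \<alpha> r (s4_coord_bracket \<alpha> p q) k = 0"
  unfolding s4_coord_bracket_nested s4_ad_commute by (simp add: algebra_simps)

theorem s4_algebra_exists:
  fixes \<alpha> :: "nat \<Rightarrow> complex"
  assumes "2 \<le> n" and card: "CARD('m::finite) = n + 1"
  shows "\<exists>bracket e x. s4_algebra ((*s) :: complex \<Rightarrow> complex ^ 'm \<Rightarrow> complex ^ 'm) bracket n \<alpha> e x"
proof -
  have "card {0..n} = card (UNIV :: 'm set)"
    using card by simp
  then obtain h :: "nat \<Rightarrow> 'm" where h: "bij_betw h {0..n} UNIV"
    using finite_same_card_bij[of "{0..n}" "UNIV :: 'm set"] by auto
  define g where "g = inv_into {0..n} h"
  have gh: "g (h i) = i" if "i \<le> n" for i
    using h that by (simp add: g_def bij_betw_inv_into_left)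
  have hg: "h (g j) = j" and g_le: "g j \<le> n" for j
    using h bij_betw_inv_into_right[OF h] bij_betw_apply[OF bij_betw_inv_into[OF h]]
    by (auto simp: g_def)
  define co where "co = (\<lambda>(u :: complex ^ 'm) i. if i \<le> n then u $ h i else 0)"
  define br where "br = (\<lambda>(u :: complex ^ 'm) v. (\<chi> j. s4_coord_bracket \<alpha> (co u) (co v) (g j)) :: complex ^ 'm)"
  define e where "e = (\<lambda>i. axis (h i) (1::complex))"
  have co_add: "co (u + v) = (\<lambda>i. co u i + co v i)" for u v
    by (auto simp: co_def)
  have co_scale: "co (c *s u) = (\<lambda>i. c * co u i)" for c u
    by (auto simp: co_def)
  have co_e: "co (e i) = (\<lambda>k. if k = i then 1 else 0)" if "i \<le> n" for i
    proof
    fix k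
    show "co (e i) k = (if k = i then 1 else 0)"
      using that gh[of i] gh[of k] by (auto simp: co_def e_def axis_def)
  qed
  have co_br: "s4_coord_bracket \<alpha> p (co (br u v)) k = s4_coord_bracket \<alpha> p (s4_coord_bracket \<alpha> (co u) (co v)) k"
    if "k \<le> n" for p u v k
  proof -
    have "co (br u v) i = s4_coord_bracket \<alpha> (co u) (co v) i" if "i \<le> n" for i
      using that by (simp add: co_def br_def gh)
    then show ?thesis
      using that \<open>2 \<le> n\<close> s4_ad_cong[of k "co (br u v)" "s4_coord_bracket \<alpha> (co u) (co v)"]
      unfolding s4_coord_bracket_def[of \<alpha> p] by simp
  qed
  have br_e: "br (e i) (e k) $ j = s4_coord_bracket \<alpha> (\<lambda>m. if m = i then 1 else 0) (\<lambda>m. if m = k then 1 else 0) (g j)"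
    if "i \<le> n" "k \<le> n" for i j k
    using that by (simp add: br_def co_e)
  have e_nth: "e i $ j = (if g j = i then 1 else 0)" if "i \<le> n" for i j
    using that gh hg by (auto simp: e_def axis_def)
  have inj: "inj_on e {0..n}"
    using bij_betw_imp_inj_on[OF h] by (auto simp: inj_on_def e_def axis_eq_axis)
  have split: "{0..n} = insert 0 {1..n}" by auto
  have basis: "insert (e 0) (e ` {1..n}) = cart_basis"
  proof -
    have "insert (e 0) (e ` {1..n}) = (\<lambda>j. axis j 1) ` (h ` {0..n})"
      unfolding split by (auto simp: e_def)
    then show ?thesis
      using bij_betw_imp_surj_on[OF h] by (auto simp: cart_basis_def)
  qed
  have ad_e1: "s4_ad_e1 (\<lambda>m. if m = i then 1 else 0) k = (if 2 \<le> i \<and> k = i + 1 then 1 else 0)" for i k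
    by (auto simp: s4_ad_e1_def)
  have ad_x: "s4_ad_x \<alpha> (\<lambda>m. if m = i then 1 else 0) k =
      (if 2 \<le> i \<and> i \<le> k then if k = i then 1 else if i + 2 \<le> k then \<alpha> (k + 1 - i) else 0 else 0)" for i k
  proof -
    have "(\<Sum>j = 2..<k-1. \<alpha> (k + 1 - j) * (if j = i then 1 else 0))
        = (\<Sum>j = 2..<k-1. if j = i then \<alpha> (k + 1 - j) else 0)"
      by (rule sum.cong) auto
    also have "\<dots> = (if i \<in> {2..<k-1} then \<alpha> (k + 1 - i) else 0)"
      by (rule sum.delta) simp
    finally show ?thesis
      by (auto simp: s4_ad_x_def)
  qed
  have "s4_algebra (*s) br n \<alpha> e (e 0)"
  proof
    show "br (u + v) w = br u w + br v w" for u v w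
      by (simp add: vec_eq_iff br_def s4_coord_bracket_def co_add s4_ad_add algebra_simps)
    show "br u (v + w) = br u v + br u w" for u v w
      by (simp add: vec_eq_iff br_def s4_coord_bracket_def co_add s4_ad_add algebra_simps)
    show "br (c *s u) v = c *s br u v" for c u v
      by (simp add: vec_eq_iff br_def s4_coord_bracket_def co_scale s4_ad_scale algebra_simps)
    show "br u (c *s v) = c *s br u v" for c u v
      by (simp add: vec_eq_iff br_def s4_coord_bracket_def co_scale s4_ad_scale algebra_simps)
    show "br u u = 0" for u
      by (simp add: vec_eq_iff br_def s4_coord_bracket_def)
    have "br u (br v w) $ j = s4_coord_bracket \<alpha> (co u) (s4_coord_bracket \<alpha> (co v) (co w)) (g j)" for u v w j
      by (subst br_def) (simp add: co_br[OF g_le])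
    then show "br u (br v w) + br v (br w u) + br w (br u v) = 0" for u v w
      by (simp add: vec_eq_iff s4_coord_bracket_jacobi)
    show "inj_on e {1..n}"
      using inj by (rule inj_on_subset) auto
    show "e 0 \<notin> e ` {1..n}"
      using inj unfolding split by simp
    show "vec.independent (insert (e 0) (e ` {1..n}))"
      unfolding basis by (rule independent_cart_basis)
    show "vec.span (insert (e 0) (e ` {1..n})) = UNIV"
      unfolding basis by (rule span_cart_basis)
    show "br (e i) (e 1) = e (i + 1)" if "i \<in> {2..n-1}" for i
      using that \<open>2 \<le> n\<close>
      by (auto simp: vec_eq_iff br_e e_nth s4_coord_bracket_def ad_e1 ad_x)
    show "br (e i) (e 0) = e i + (\<Sum>l = i+2..n. \<alpha> (l + 1 - i) *s e l)" if i: "i \<in> {2..n}" for i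
    proof -
      have "(\<Sum>l = i+2..n. \<alpha> (l + 1 - i) *s e l) $ j = (if i + 2 \<le> g j then \<alpha> (g j + 1 - i) else 0)" for j
      proof -
        have "(\<Sum>l = i+2..n. \<alpha> (l + 1 - i) *s e l) $ j
            = (\<Sum>l = i+2..n. \<alpha> (l + 1 - i) * e l $ j)"
          by (simp add: sum_component)
        also have "\<dots> = (\<Sum>l = i+2..n. if l = g j then \<alpha> (l + 1 - i) else 0)"
          by (rule sum.cong) (auto simp: e_nth)
        also have "\<dots> = (if g j \<in> {i+2..n} then \<alpha> (g j + 1 - i) else 0)"
          by (rule sum.delta) simp
        finally show ?thesis using g_le[of j] by simp
      qed
      then show ?thesis
        using i by (auto simp: vec_eq_iff br_e e_nth s4_coord_bracket_def ad_e1 ad_x)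
    qed
    show "br (e n) (e 1) = 0"
    proof -
      have "g j \<noteq> Suc n" for j
        using g_le[of j] by simp
      then show ?thesis
        using \<open>2 \<le> n\<close> by (auto simp: vec_eq_iff br_e s4_coord_bracket_def ad_e1 ad_x)
    qed
    show "br (e 1) (e 0) = 0"
      using \<open>2 \<le> n\<close> by (auto simp: vec_eq_iff br_e s4_coord_bracket_def ad_e1 ad_x)
    show "br (e i) (e j) = 0" if "i \<in> {2..n}" "j \<in> {2..n}" for i j
      using that by (auto simp: vec_eq_iff br_e s4_coord_bracket_def ad_e1 ad_x)
  qed
  then show ?thesis by blast
qed

end

theory Submission
  imports Defs
begin

text \<open>
  Subtracting a multiple of the identity, which is itself a half-derivation, we may assume that the
  \<open>e 1\<close>-component of \<open>\<phi> (e 1)\<close> vanishes. Then \<open>\<phi>\<close> kills the span of \<open>e 2, \<dots>, e n\<close>: the brackets with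
  \<open>e 1\<close> show that \<open>\<phi> (e (i + 2))\<close> is \<open>\<phi> (e 2)\<close> shifted by \<open>i\<close> and divided by \<open>2 ^ i\<close>, and comparing this with
  the brackets with \<open>x\<close> forces \<open>\<phi> (e 2) = 0\<close>. Finally \<open>[\<phi> (e 1), x] + [e 1, \<phi> x] = 0\<close> expresses
  \<open>\<phi> x\<close> through \<open>\<phi> (e 1)\<close>.
\<close>

section \<open>The linear system for the coefficients of a half-derivation\<close>

definition unit_coord :: "nat \<Rightarrow> nat \<Rightarrow> complex" where
  "unit_coord i k = (if k = i then 1 else 0)"

lemma s4_ad_e1_unit_coord:
  "s4_ad_e1 (unit_coord i) k = (if 2 \<le> i \<and> k = i + 1 then 1 else 0)"
  by (auto simp: s4_ad_e1_def unit_coord_def)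

lemma s4_ad_x_unit_coord:
  "s4_ad_x \<alpha> (unit_coord i) k =
     (if 2 \<le> i then if k = i then 1 else if i + 2 \<le> k then \<alpha> (k + 1 - i) else 0 else 0)"
proof -
  have "(\<Sum>j = 2..<k-1. \<alpha> (k + 1 - j) * unit_coord i j)
      = (\<Sum>j = 2..<k-1. if j = i then \<alpha> (k + 1 - j) else 0)"
    by (rule sum.cong) (auto simp: unit_coord_def)
  also have "\<dots> = (if i \<in> {2..<k-1} then \<alpha> (k + 1 - i) else 0)"
    by (rule sum.delta) simp
  finally show ?thesis
    by (auto simp: s4_ad_x_def unit_coord_def)
qed

text \<open>The bracket with \<open>x\<close> is unitriangular, so it acts as the identity on the
  lowest nonzero coordinate. Against the factor 2 in the half-derivation equations this yields
  relations of the shape 2z = z + r.\<close>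

lemma s4_ad_x_eq_self:
  assumes "2 \<le> k" "\<And>j. 2 \<le> j \<Longrightarrow> j < k \<Longrightarrow> p j = 0"
  shows "s4_ad_x \<alpha> p k = p k"
proof -
  have "(\<Sum>j = 2..<k-1. \<alpha> (k + 1 - j) * p j) = 0"
    using assms by (intro sum.neutral) auto
  then show ?thesis
    using assms by (simp add: s4_ad_x_def)
qed

text \<open>
  Here \<open>f i\<close> is the coordinate vector of \<open>\<phi> (e i)\<close>, \<open>c\<close> the \<open>x\<close>-coordinate of \<open>\<phi> (e 1)\<close>, and \<open>b\<close>, \<open>d\<close>
  are the \<open>e 1\<close>- and \<open>x\<close>-coordinates of \<open>\<phi> x\<close>.
\<close>
lemma half_derivation_coefficients:
  fixes f :: "nat \<Rightarrow> nat \<Rightarrow> complex"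
  assumes n: "n \<ge> 4"
    and shift: "\<And>i k. 2 \<le> i \<Longrightarrow> i < n \<Longrightarrow> k \<le> n \<Longrightarrow>
      2 * f (i + 1) k = s4_ad_e1 (f i) k + c * s4_ad_x \<alpha> (unit_coord i) k"
    and top: "\<And>k. k \<le> n \<Longrightarrow> s4_ad_e1 (f n) k + c * s4_ad_x \<alpha> (unit_coord n) k = 0"
    and diag: "\<And>i k. 2 \<le> i \<Longrightarrow> i \<le> n \<Longrightarrow> k \<le> n \<Longrightarrow>
      2 * (f i k + (\<Sum>l = i+2..n. \<alpha> (l + 1 - i) * f l k)) =
        s4_ad_x \<alpha> (f i) k + b * s4_ad_e1 (unit_coord i) k + d * s4_ad_x \<alpha> (unit_coord i) k"
  shows "c = 0" "b = 0" "d = 0" "\<And>i k. 2 \<le> i \<Longrightarrow> i \<le> n \<Longrightarrow> k \<le> n \<Longrightarrow> f i k = 0"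
proof -
  \<comment> \<open>For i = n the sum in \<open>diag\<close> is empty and the \<open>b\<close> and
    \<open>d\<close> terms vanish at k < n. By induction on k this leaves 2 z = z for z =
    \<open>f n k\<close>.\<close>
  have fn: "f n k = 0" if "2 \<le> k" "k < n" for k
    using that
  proof (induction k rule: less_induct)
    case (less k)
    have "s4_ad_x \<alpha> (f n) k = f n k"
      using less by (intro s4_ad_x_eq_self) auto
    then show ?case
      using diag[of n k] less.prems n by (simp add: s4_ad_e1_unit_coord s4_ad_x_unit_coord)
  qed
  have fnn: "f n n = d"
  proof -
    have "s4_ad_x \<alpha> (f n) n = f n n"
      using n fn by (intro s4_ad_x_eq_self) auto
    then show ?thesis
      using diag[of n n] n by (simp add: s4_ad_e1_unit_coord s4_ad_x_unit_coord)
  qed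
  \<comment> \<open>At k = n the shift in \<open>top\<close> contributes \<open>f n (n - 1)\<close>,
    which is 0 by \<open>fn\<close>, and the other term is \<open>c\<close> itself.\<close>
  show c: "c = 0"
    using top[of n] n fn[of "n - 1"] by (simp add: s4_ad_e1_def s4_ad_x_unit_coord)
  \<comment> \<open>With c = 0, \<open>shift\<close> makes \<open>f i\<close> half a shift of
    \<open>f (i - 1)\<close>, and a shift has no entries below 3. The case i = 2 has no predecessor
    and is settled by \<open>diag\<close> in \<open>low\<close>.\<close>
  have low3: "f i k = 0" if "3 \<le> i" "i \<le> n" "k < 2" for i k
    using shift[of "i - 1" k] that n by (simp add: s4_ad_e1_def c)
  have low: "f i k = 0" if "2 \<le> i" "i \<le> n" "k < 2" for i k
  proof (cases "i = 2")
    case True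
    have "(\<Sum>l = 4..n. \<alpha> (l + 1 - 2) * f l k) = 0"
      using that by (intro sum.neutral) (auto simp: low3)
    then show ?thesis
      using True diag[of 2 k] that n
      by (simp add: s4_ad_e1_unit_coord s4_ad_x_unit_coord) (simp add: s4_ad_x_def)
  qed (use that low3 in auto)
  have shifted: "2 ^ m * f (2 + m) k = (if m + 2 \<le> k then f 2 (k - m) else 0)"
    if "2 + m \<le> n" "k \<le> n" for m k
    using that
  proof (induction m arbitrary: k)
    case 0
    then show ?case using low[of 2 k] n by auto
  next
    case (Suc m)
    have "2 ^ Suc m * f (2 + Suc m) k = 2 ^ m * (2 * f (2 + m + 1) k)"
      by simp
    also have "\<dots> = 2 ^ m * s4_ad_e1 (f (2 + m)) k"
      using Suc.prems shift[of "2 + m" k] by (simp add: c)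
    also have "\<dots> = (if 3 \<le> k then 2 ^ m * f (2 + m) (k - 1) else 0)"
      by (simp add: s4_ad_e1_def)
    also have "2 ^ m * f (2 + m) (k - 1) = (if m + 2 \<le> k - 1 then f 2 (k - 1 - m) else 0)"
      using Suc.prems by (intro Suc.IH) auto
    also have "k - 1 - m = k - Suc m"
      by simp
    finally show ?case
      by (simp split: if_splits)
  qed
  have shifted': "2 ^ (l - 2) * f l k = (if l \<le> k then f 2 (k - (l - 2)) else 0)"
    if "2 \<le> l" "l \<le> n" "k \<le> n" for l k
  proof -
    obtain m where "l = 2 + m"
      using \<open>2 \<le> l\<close> le_Suc_ex by blast
    with shifted[of m k] that show ?thesis
      by (simp add: add.commute)
  qed
  \<comment> \<open>The matrix of entries \<open>f l k\<close> is triangular, and by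
    \<open>shifted'\<close> its first row \<open>f 2\<close> determines it, each further row costing
    a factor 1/2.\<close>
  have upper: "f l k = 0" if "2 \<le> l" "l \<le> n" "k < l" for l k
    using shifted'[of l k] that by simp
  have sum0: "(\<Sum>l = i+2..n. \<alpha> (l + 1 - i) * f l k) = 0" if "k < i + 2" for i k
    using that by (intro sum.neutral) (auto simp: upper)
  have f22: "f 2 2 = d"
    using diag[of 2 2] sum0[of 2 2] n s4_ad_x_eq_self[of 2 "f 2" \<alpha>]
    by (simp add: s4_ad_e1_unit_coord s4_ad_x_unit_coord)
  \<comment> \<open>The corner entry is computed twice: \<open>diag\<close> gives
    \<open>f n n = d\<close>, whereas shifting \<open>f 2 2 = d\<close> down the diagonal gives d
    divided by 2 ^ (n - 2).\<close>
  show d: "d = 0"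
  proof (rule ccontr)
    assume "d \<noteq> 0"
    moreover have "2 ^ (n - 2) * d = d"
      using shifted'[of n n] n by (simp add: fnn f22)
    ultimately have "(2::complex) ^ (n - 2) = 1"
      by simp
    then have "(2::real) ^ (n - 2) = 1"
      by (metis norm_numeral norm_one norm_power)
    then show False
      using n one_less_power[of "2::real" "n - 2"] by simp
  qed
  \<comment> \<open>The same comparison one place above the diagonal: \<open>diag\<close> gives b
    for both \<open>f 2 3\<close> and \<open>f 3 4\<close>, but \<open>shift\<close> halves the
    entry from one row to the next. The second entry exists because n \<ge> 4.\<close>
  have f23: "f 2 3 = b"
  proof -
    have "s4_ad_x \<alpha> (f 2) 3 = f 2 3"
    proof (rule s4_ad_x_eq_self)
      fix j :: nat
      assume "2 \<le> j" "j < 3"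
      then have "j = 2"
        by simp
      then show "f 2 j = 0"
        by (simp add: f22 d)
    qed simp
    then show ?thesis
      using diag[of 2 3] sum0[of 3 2] n by (simp add: s4_ad_e1_unit_coord d)
  qed
  have "f 3 4 = b"
  proof -
    have "s4_ad_x \<alpha> (f 3) 4 = f 3 4"
    proof (rule s4_ad_x_eq_self)
      fix j :: nat
      assume j: "2 \<le> j" "j < 4"
      show "f 3 j = 0"
        using upper[of 3 j] shifted'[of 3 3] f22 d n j by (cases "j = 3") auto
    qed simp
    then show ?thesis
      using diag[of 3 4] sum0[of 4 3] n by (simp add: s4_ad_e1_unit_coord d)
  qed
  moreover have "2 * f 3 4 = f 2 3"
    using shifted'[of 3 4] n by simp
  ultimately show b: "b = 0"
    using f23 by simp
  \<comment> \<open>For l \<ge> 4 the entry \<open>f l k\<close> is a multiple of an entry of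
    \<open>f 2\<close> with index below k, so the induction hypothesis removes the whole
    \<alpha>-sum from \<open>diag\<close>.\<close>
  have f2: "f 2 k = 0" if "k \<le> n" for k
    using that
  proof (induction k rule: less_induct)
    case (less k)
    have "f l k = 0" if "4 \<le> l" "l \<le> n" for l
      using shifted'[of l k] that less.prems less.IH[of "k - (l - 2)"] by (cases "k < l") (auto simp: upper)
    then have "(\<Sum>l = 2+2..n. \<alpha> (l + 1 - 2) * f l k) = 0"
      by (intro sum.neutral) auto
    then have "2 * f 2 k = s4_ad_x \<alpha> (f 2) k"
      using diag[of 2 k] less.prems n by (simp add: b d)
    also have "\<dots> = (if 2 \<le> k then f 2 k else 0)"
      using less s4_ad_x_eq_self[of k "f 2" \<alpha>] by (auto simp: s4_ad_x_def)
    finally show ?case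
      by (auto split: if_splits)
  qed
  show "f i k = 0" if "2 \<le> i" "i \<le> n" "k \<le> n" for i k
    using shifted'[of i k] that f2[of "k - (i - 2)"] by (auto split: if_splits)
qed

section \<open>Bilinearity of the bracket and shifting a half-derivation by a scalar\<close>

context complex_lie_algebra
begin

lemma bracket_zero_left [simp]: "[0, v]\<^sub>L = 0"
  using bracket_add_left[of 0 0 v] by simp

lemma bracket_zero_right [simp]: "[u, 0]\<^sub>L = 0"
  using bracket_add_right[of u 0 0] by simp

lemma bracket_sum_left: "[sum g A, v]\<^sub>L = (\<Sum>i\<in>A. [g i, v]\<^sub>L)"
  by (induction A rule: infinite_finite_induct) (auto simp: bracket_add_left)

lemma bracket_sum_right: "[u, sum g A]\<^sub>L = (\<Sum>i\<in>A. [u, g i]\<^sub>L)"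
  by (induction A rule: infinite_finite_induct) (auto simp: bracket_add_right)

lemma bracket_antisym: "[u, v]\<^sub>L = - [v, u]\<^sub>L"
  using bracket_self[of "u + v", unfolded bracket_add_left bracket_add_right]
  by (simp add: bracket_self eq_neg_iff_add_eq_0 add.commute)

lemma bracket_minus_left: "[- u, v]\<^sub>L = - [u, v]\<^sub>L"
  using bracket_add_left[of u "- u" v] by (simp add: eq_neg_iff_add_eq_0 add.commute)

lemma bracket_minus_right: "[u, - v]\<^sub>L = - [u, v]\<^sub>L"
  using bracket_add_right[of u v "- v"] by (simp add: eq_neg_iff_add_eq_0 add.commute)

text \<open>The factor 1/2 compensates for the two equal terms c[u, v] that a scalar map produces on
  the right.\<close>

lemma half_derivation_diff_scale:
  assumes "half_derivation smul bracket \<phi>"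
  shows "half_derivation smul bracket (\<lambda>u. \<phi> u - c *\<^sub>C u)"
proof -
  have lin: "Vector_Spaces.linear smul smul \<phi>"
    and half: "\<And>u v. \<phi> [u, v]\<^sub>L = (1/2) *\<^sub>C ([\<phi> u, v]\<^sub>L + [u, \<phi> v]\<^sub>L)"
    using assms by (auto simp: half_derivation_def)
  interpret \<phi>: Vector_Spaces.linear smul smul \<phi>
    by (rule lin)
  have "Vector_Spaces.linear smul smul (\<lambda>u. \<phi> u - c *\<^sub>C u)"
    by unfold_locales
      (simp_all add: \<phi>.add \<phi>.scale scale_right_distrib scale_right_diff_distrib scale_left_commute)
  moreover have "\<phi> [u, v]\<^sub>L - c *\<^sub>C [u, v]\<^sub>L =
      (1/2) *\<^sub>C ([\<phi> u - c *\<^sub>C u, v]\<^sub>L + [u, \<phi> v - c *\<^sub>C v]\<^sub>L)" for u v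
  proof -
    have "[\<phi> u - c *\<^sub>C u, v]\<^sub>L + [u, \<phi> v - c *\<^sub>C v]\<^sub>L
        = ([\<phi> u, v]\<^sub>L + [u, \<phi> v]\<^sub>L) - (c *\<^sub>C [u, v]\<^sub>L + c *\<^sub>C [u, v]\<^sub>L)"
      using bracket_add_left[of "\<phi> u" "- (c *\<^sub>C u)" v] bracket_add_right[of u "\<phi> v" "- (c *\<^sub>C v)"]
      by (simp add: bracket_minus_left bracket_minus_right bracket_scale_left bracket_scale_right)
    moreover have "(1/2) *\<^sub>C (c *\<^sub>C [u, v]\<^sub>L + c *\<^sub>C [u, v]\<^sub>L) = c *\<^sub>C [u, v]\<^sub>L"
      by (simp add: scale_right_distrib flip: scale_left_distrib)
    ultimately show ?thesis
      by (simp only: half scale_right_diff_distrib)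
  qed
  ultimately show ?thesis
    by (simp add: half_derivation_def)
qed

end

text \<open>Otherwise the simplifier rewrites \<open>e 1\<close> to \<open>e (Suc 0)\<close>, where the bracket relations do not match.\<close>
declare One_nat_def [simp del]

section \<open>Coordinates and the bracket in coordinates\<close>

context s4_algebra
begin

text \<open>Giving \<open>x\<close> the index 0 matches the convention of
  \<open>s4_coord_bracket\<close>.\<close>

definition bas :: "nat \<Rightarrow> 'v" where
  "bas k = (if k = 0 then x else e k)"

text \<open>For k > n the vector \<open>bas k\<close> is arbitrary, so only indices up to n carry
  meaning; hence the bounds k \<le> n in what follows.\<close>

definition coord :: "'v \<Rightarrow> nat \<Rightarrow> complex" where
  "coord u k = representation (bas ` {0..n}) u (bas k)"

lemma bas_image: "bas ` {0..n} = insert x (e ` {1..n})"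
proof -
  have "{0..n} = insert 0 {1..n}"
    by auto
  then show ?thesis
    by (auto simp: bas_def)
qed

lemma independent_bas: "independent (bas ` {0..n})"
  using basis_independent by (simp add: bas_image)

lemma in_span_bas: "u \<in> span (bas ` {0..n})"
  using basis_span by (simp add: bas_image)

lemma inj_on_bas: "inj_on bas {0..n}"
proof (rule inj_onI)
  fix i j
  assume ij: "i \<in> {0..n}" "j \<in> {0..n}" and "bas i = bas j"
  have "e k \<noteq> x" if "k \<in> {0..n}" "k \<noteq> 0" for k
    using basis_x that by force
  with ij \<open>bas i = bas j\<close> inj_onD[OF basis_inj, of i j] show "i = j"
    by (cases "i = 0"; cases "j = 0") (auto simp: bas_def)
qed

lemma coord_bas: "i \<le> n \<Longrightarrow> k \<le> n \<Longrightarrow> coord (bas i) k = unit_coord i k"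
  using inj_on_bas
  by (auto simp: coord_def unit_coord_def representation_basis[OF independent_bas] inj_on_eq_iff)

lemma coord_add: "coord (u + v) k = coord u k + coord v k"
  by (simp add: coord_def representation_add[OF independent_bas] in_span_bas)

lemma coord_scale: "coord (c *\<^sub>C u) k = c * coord u k"
  by (simp add: coord_def representation_scale[OF independent_bas] in_span_bas)

lemma coord_zero: "coord 0 k = 0"
  by (simp add: coord_def representation_zero)

lemma coord_minus: "coord (- u) k = - coord u k"
  by (simp add: coord_def representation_neg[OF independent_bas] in_span_bas)

lemma coord_diff: "coord (u - v) k = coord u k - coord v k"
  by (simp add: coord_def representation_diff[OF independent_bas] in_span_bas)

lemma coord_sum: "coord (sum g A) k = (\<Sum>i\<in>A. coord (g i) k)"
  by (induction A rule: infinite_finite_induct) (auto simp: coord_add coord_zero)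

lemma coord_expansion: "u = (\<Sum>k = 0..n. coord u k *\<^sub>C bas k)"
proof -
  have "u = (\<Sum>b\<in>bas ` {0..n}. representation (bas ` {0..n}) u b *\<^sub>C b)"
    by (rule sum_representation_eq[symmetric]) (auto simp: independent_bas in_span_bas)
  also have "\<dots> = (\<Sum>k = 0..n. coord u k *\<^sub>C bas k)"
    by (simp add: sum.reindex[OF inj_on_bas] coord_def)
  finally show ?thesis .
qed

lemma coord_expansion_e:
  assumes "2 \<le> n"
  shows "u = coord u 0 *\<^sub>C x + coord u 1 *\<^sub>C e 1 + (\<Sum>k = 2..n. coord u k *\<^sub>C e k)"
proof -
  have split: "{0..n} = insert 0 (insert 1 {2..n})"
    using assms by auto
  have "u = (\<Sum>k = 0..n. coord u k *\<^sub>C bas k)"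
    by (rule coord_expansion)
  also have "\<dots> = coord u 0 *\<^sub>C bas 0 + (coord u 1 *\<^sub>C bas 1 + (\<Sum>k = 2..n. coord u k *\<^sub>C bas k))"
    unfolding split by simp
  also have "(\<Sum>k = 2..n. coord u k *\<^sub>C bas k) = (\<Sum>k = 2..n. coord u k *\<^sub>C e k)"
    by (rule sum.cong) (auto simp: bas_def)
  finally show ?thesis
    by (simp add: bas_def add.assoc)
qed

lemma coord_eqI: "(\<And>k. k \<le> n \<Longrightarrow> coord u k = coord v k) \<Longrightarrow> u = v"
  by (subst coord_expansion[of u], subst coord_expansion[of v]) simp

lemma coord_e: "1 \<le> i \<Longrightarrow> i \<le> n \<Longrightarrow> k \<le> n \<Longrightarrow> coord (e i) k = unit_coord i k"
  using coord_bas[of i k] by (simp add: bas_def)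

lemma coord_x: "k \<le> n \<Longrightarrow> coord x k = unit_coord 0 k"
  using coord_bas[of 0 k] by (simp add: bas_def)

lemma coord_bracket_e_e1:
  assumes "2 \<le> i" "i \<le> n" "k \<le> n"
  shows "coord [e i, e 1]\<^sub>L k = s4_ad_e1 (unit_coord i) k"
proof (cases "i = n")
  case True
  then show ?thesis
    using assms by (simp add: bracket_en_e1 coord_zero s4_ad_e1_unit_coord)
next
  case False
  then show ?thesis
    using assms bracket_e_e1[of i] by (simp add: coord_e s4_ad_e1_unit_coord unit_coord_def)
qed

lemma coord_bracket_e_x:
  assumes "2 \<le> i" "i \<le> n" "k \<le> n"
  shows "coord [e i, x]\<^sub>L k = s4_ad_x \<alpha> (unit_coord i) k"
proof -
  have "(\<Sum>l = i+2..n. \<alpha> (l + 1 - i) * coord (e l) k)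
      = (\<Sum>l = i+2..n. if l = k then \<alpha> (l + 1 - i) else 0)"
    using assms by (intro sum.cong) (auto simp: coord_e unit_coord_def)
  also have "\<dots> = (if k \<in> {i+2..n} then \<alpha> (k + 1 - i) else 0)"
    by (rule sum.delta) simp
  finally show ?thesis
    using assms bracket_e_x[of i]
    by (auto simp: coord_add coord_sum coord_scale coord_e s4_ad_x_unit_coord unit_coord_def)
qed

lemma coord_bracket_e1:
  assumes "2 \<le> n" "k \<le> n"
  shows "coord [u, e 1]\<^sub>L k = s4_ad_e1 (coord u) k"
proof -
  have "[u, e 1]\<^sub>L = (\<Sum>i = 2..n. coord u i *\<^sub>C [e i, e 1]\<^sub>L)"
    by (subst coord_expansion_e[OF assms(1), of u])
      (simp add: bracket_add_left bracket_scale_left bracket_sum_left bracket_self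
        bracket_antisym[of x "e 1"] bracket_e1_x)
  then have "coord [u, e 1]\<^sub>L k = (\<Sum>i = 2..n. coord u i * s4_ad_e1 (unit_coord i) k)"
    using assms by (simp add: coord_sum coord_scale coord_bracket_e_e1)
  \<comment> \<open>Only i = k - 1 contributes. For k < 3 this index lies outside the range or the
    value is 0, in agreement with \<open>s4_ad_e1\<close>.\<close>
  also have "\<dots> = (\<Sum>i = 2..n. if i = k - 1 then s4_ad_e1 (coord u) k else 0)"
    by (intro sum.cong) (auto simp: s4_ad_e1_unit_coord s4_ad_e1_def[of "coord u"])
  also have "\<dots> = s4_ad_e1 (coord u) k"
    using assms by (auto simp: s4_ad_e1_def)
  finally show ?thesis .
qed

lemma coord_bracket_x:
  assumes "2 \<le> n" "k \<le> n"
  shows "coord [u, x]\<^sub>L k = s4_ad_x \<alpha> (coord u) k"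
proof -
  have "[u, x]\<^sub>L = (\<Sum>i = 2..n. coord u i *\<^sub>C [e i, x]\<^sub>L)"
    by (subst coord_expansion_e[OF assms(1), of u])
      (simp add: bracket_add_left bracket_scale_left bracket_sum_left bracket_self bracket_e1_x)
  then have *: "coord [u, x]\<^sub>L k = (\<Sum>i = 2..n. coord u i * s4_ad_x \<alpha> (unit_coord i) k)"
    using assms by (simp add: coord_sum coord_scale coord_bracket_e_x)
  \<comment> \<open>Each summand splits into its diagonal part and its \<alpha>-part, which are then
    summed separately.\<close>
  have "(\<Sum>i = 2..n. coord u i * s4_ad_x \<alpha> (unit_coord i) k)
      = (\<Sum>i = 2..n. (if i = k then coord u i else 0)
          + (if i \<in> {2..<k-1} then \<alpha> (k + 1 - i) * coord u i else 0))"
    by (intro sum.cong) (auto simp: s4_ad_x_unit_coord)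
  also have "\<dots> = (if k \<in> {2..n} then coord u k else 0)
      + (\<Sum>i \<in> {2..n} \<inter> {2..<k-1}. \<alpha> (k + 1 - i) * coord u i)"
    by (simp add: sum.distrib sum.inter_restrict)
  also have "{2..n} \<inter> {2..<k-1} = {2..<k-1}"
    using assms by auto
  finally show ?thesis
    using assms * by (auto simp: s4_ad_x_def)
qed

text \<open>The elements \<open>e 2\<close>, ..., \<open>e n\<close> commute with each other, so
  only brackets with \<open>e 1\<close> and \<open>x\<close> survive. Since \<open>e 1\<close> and
  \<open>x\<close> commute, these brackets see only the parts \<open>u'\<close> and
  \<open>v'\<close>.\<close>

lemma coord_bracket:
  assumes "2 \<le> n" "k \<le> n"
  shows "coord [u, v]\<^sub>L k = s4_coord_bracket \<alpha> (coord u) (coord v) k"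
proof -
  define u' where "u' = (\<Sum>i = 2..n. coord u i *\<^sub>C e i)"
  define v' where "v' = (\<Sum>i = 2..n. coord v i *\<^sub>C e i)"
  have u: "u = coord u 0 *\<^sub>C x + coord u 1 *\<^sub>C e 1 + u'"
    unfolding u'_def by (rule coord_expansion_e[OF assms(1)])
  have v: "v = coord v 0 *\<^sub>C x + coord v 1 *\<^sub>C e 1 + v'"
    unfolding v'_def by (rule coord_expansion_e[OF assms(1)])
  have "[u', v']\<^sub>L = 0"
    unfolding u'_def v'_def
    by (simp add: bracket_sum_left bracket_sum_right bracket_scale_left bracket_scale_right bracket_e_e)
  moreover have "[u, v]\<^sub>L = coord v 0 *\<^sub>C [u, x]\<^sub>L + coord v 1 *\<^sub>C [u, e 1]\<^sub>L + [u, v']\<^sub>L"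
    by (subst (1) v) (simp add: bracket_add_right bracket_scale_right)
  moreover have "[u, v']\<^sub>L = coord u 0 *\<^sub>C [x, v']\<^sub>L + coord u 1 *\<^sub>C [e 1, v']\<^sub>L + [u', v']\<^sub>L"
    by (subst (1) u) (simp add: bracket_add_left bracket_scale_left)
  moreover have "[v', x]\<^sub>L = [v, x]\<^sub>L" "[v', e 1]\<^sub>L = [v, e 1]\<^sub>L"
    by (subst v; simp add: bracket_add_left bracket_scale_left bracket_self bracket_e1_x
        bracket_antisym[of x "e 1"])+
  then have "[x, v']\<^sub>L = - [v, x]\<^sub>L" "[e 1, v']\<^sub>L = - [v, e 1]\<^sub>L"
    by (metis bracket_antisym)+
  ultimately show ?thesis
    using assms
    by (simp add: coord_add coord_scale coord_minus coord_diff coord_bracket_x coord_bracket_e1 s4_coord_bracket_def)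
qed

section \<open>Half-derivations in coordinates\<close>

lemma coord_half_derivation:
  assumes "2 \<le> n" "half_derivation smul bracket \<phi>" "k \<le> n"
  shows "2 * coord (\<phi> [u, v]\<^sub>L) k =
    s4_coord_bracket \<alpha> (coord (\<phi> u)) (coord v) k + s4_coord_bracket \<alpha> (coord u) (coord (\<phi> v)) k"
proof -
  have "\<phi> [u, v]\<^sub>L = (1/2) *\<^sub>C ([\<phi> u, v]\<^sub>L + [u, \<phi> v]\<^sub>L)"
    using assms by (simp add: half_derivation_def)
  then show ?thesis
    using assms by (simp add: coord_scale coord_add coord_bracket)
qed

text \<open>\<open>coord (e 1)\<close> and \<open>unit_coord 1\<close> are known to agree only up to
  n. This suffices because entry k of either map reads only indices up to k.\<close>

lemma s4_coord_bracket_e1_right: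
  assumes "2 \<le> n" "k \<le> n"
  shows "s4_coord_bracket \<alpha> p (coord (e 1)) k = s4_ad_e1 p k"
proof -
  have "s4_ad_e1 (coord (e 1)) k = s4_ad_e1 (unit_coord 1) k"
    and "s4_ad_x \<alpha> (coord (e 1)) k = s4_ad_x \<alpha> (unit_coord 1) k"
    using assms by (intro s4_ad_cong; simp add: coord_e)+
  then show ?thesis
    using assms
    by (simp add: s4_coord_bracket_def s4_ad_e1_unit_coord s4_ad_x_unit_coord)
      (simp add: coord_e unit_coord_def)
qed

lemma s4_coord_bracket_x_right:
  assumes "2 \<le> n" "k \<le> n"
  shows "s4_coord_bracket \<alpha> p (coord x) k = s4_ad_x \<alpha> p k"
proof -
  have "s4_ad_e1 (coord x) k = s4_ad_e1 (unit_coord 0) k"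
    and "s4_ad_x \<alpha> (coord x) k = s4_ad_x \<alpha> (unit_coord 0) k"
    using assms by (intro s4_ad_cong; simp add: coord_x)+
  then show ?thesis
    using assms
    by (simp add: s4_coord_bracket_def s4_ad_e1_unit_coord s4_ad_x_unit_coord)
      (simp add: coord_x unit_coord_def)
qed

lemma s4_coord_bracket_e_left:
  assumes "2 \<le> i" "i \<le> n" "k \<le> n"
  shows "s4_coord_bracket \<alpha> (coord (e i)) q k =
    q 1 * s4_ad_e1 (unit_coord i) k + q 0 * s4_ad_x \<alpha> (unit_coord i) k"
proof -
  have "s4_ad_e1 (coord (e i)) k = s4_ad_e1 (unit_coord i) k"
    and "s4_ad_x \<alpha> (coord (e i)) k = s4_ad_x \<alpha> (unit_coord i) k"
    using assms by (intro s4_ad_cong; simp add: coord_e)+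
  then show ?thesis
    using assms by (simp add: s4_coord_bracket_def) (simp add: coord_e unit_coord_def)
qed

lemma half_derivation_normalized:
  assumes n: "n \<ge> 4" and half: "half_derivation smul bracket \<phi>" and "coord (\<phi> (e 1)) 1 = 0"
  shows "\<And>i. i \<in> {2..n} \<Longrightarrow> \<phi> (e i) = 0"
    and "coord (\<phi> (e 1)) 0 = 0" "coord (\<phi> x) 0 = 0" "coord (\<phi> x) 1 = 0"
    and "coord (\<phi> (e 1)) 2 = 0"
    and "\<And>i. i \<in> {2..n-1} \<Longrightarrow> coord (\<phi> x) i = s4_ad_x \<alpha> (coord (\<phi> (e 1))) (i + 1)"
proof -
  interpret \<phi>: Vector_Spaces.linear smul smul \<phi>
    using half by (simp add: half_derivation_def)
  have n2: "2 \<le> n"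
    using n by simp
  \<comment> \<open>The normalization enters here: in general there is a further term, the
    \<open>e 1\<close>-coordinate of \<open>\<phi> (e 1)\<close> times
    \<open>s4_ad_e1 (unit_coord i) k\<close>.\<close>
  have e1: "2 * coord (\<phi> [e i, e 1]\<^sub>L) k = s4_ad_e1 (coord (\<phi> (e i))) k
      + coord (\<phi> (e 1)) 0 * s4_ad_x \<alpha> (unit_coord i) k"
    if "2 \<le> i" "i \<le> n" "k \<le> n" for i k
    using coord_half_derivation[OF n2 half, of k "e i" "e 1"] that n2 assms(3)
    by (simp add: s4_coord_bracket_e1_right s4_coord_bracket_e_left)
  have shift: "2 * coord (\<phi> (e (i + 1))) k = s4_ad_e1 (coord (\<phi> (e i))) k
      + coord (\<phi> (e 1)) 0 * s4_ad_x \<alpha> (unit_coord i) k"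
    if "2 \<le> i" "i < n" "k \<le> n" for i k
    using e1[of i k] that bracket_e_e1[of i] by simp
  have top: "s4_ad_e1 (coord (\<phi> (e n))) k
      + coord (\<phi> (e 1)) 0 * s4_ad_x \<alpha> (unit_coord n) k = 0" if "k \<le> n" for k
    using e1[of n k] that n2 by (simp add: bracket_en_e1 \<phi>.zero coord_zero)
  have diag: "2 * (coord (\<phi> (e i)) k + (\<Sum>l = i+2..n. \<alpha> (l + 1 - i) * coord (\<phi> (e l)) k)) =
      s4_ad_x \<alpha> (coord (\<phi> (e i))) k + coord (\<phi> x) 1 * s4_ad_e1 (unit_coord i) k
      + coord (\<phi> x) 0 * s4_ad_x \<alpha> (unit_coord i) k"
    if "2 \<le> i" "i \<le> n" "k \<le> n" for i k
    using coord_half_derivation[OF n2 half, of k "e i" x] that n2 bracket_e_x[of i]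
    by (simp add: s4_coord_bracket_x_right s4_coord_bracket_e_left \<phi>.add \<phi>.sum \<phi>.scale
        coord_add coord_sum coord_scale)
  note coefficients = half_derivation_coefficients[where f = "\<lambda>i. coord (\<phi> (e i))", OF n shift top diag]
  show "coord (\<phi> (e 1)) 0 = 0" "coord (\<phi> x) 0 = 0" "coord (\<phi> x) 1 = 0"
    by (rule coefficients; assumption)+
  show "\<phi> (e i) = 0" if "i \<in> {2..n}" for i
    using coefficients(4)[of i] that by (intro coord_eqI) (auto simp: coord_zero)
  \<comment> \<open>Since [e 1, x] = 0, the half-derivation identity turns into [\<phi> (e 1), x] =
    [\<phi> x, e 1].\<close>
  have rel: "s4_ad_x \<alpha> (coord (\<phi> (e 1))) k = s4_ad_e1 (coord (\<phi> x)) k" if "k \<le> n" for k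
  proof -
    have "coord [\<phi> (e 1), x]\<^sub>L k + coord [e 1, \<phi> x]\<^sub>L k = 0"
      using coord_half_derivation[OF n2 half that, of "e 1" x] n2 that
      by (simp add: bracket_e1_x \<phi>.zero coord_zero coord_bracket)
    then show ?thesis
      using n2 that bracket_antisym[of "e 1" "\<phi> x"]
      by (simp add: coord_minus coord_bracket_x coord_bracket_e1)
  qed
  \<comment> \<open>The right side of \<open>rel\<close> starts at index 3, while at index 2 the
    left side is just this coordinate.\<close>
  show "coord (\<phi> (e 1)) 2 = 0"
    using rel[of 2] n2 by (simp add: s4_ad_x_def s4_ad_e1_def)
  \<comment> \<open>The shift moves coordinate i to i + 1, so \<open>rel\<close> says nothing about
    coordinate n of \<open>\<phi> x\<close>; this is the free parameter
    \<open>c\<^sub>n\<close>.\<close>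
  show "coord (\<phi> x) i = s4_ad_x \<alpha> (coord (\<phi> (e 1))) (i + 1)" if "i \<in> {2..n-1}" for i
    using rel[of "i + 1"] that by (auto simp: s4_ad_e1_def)
qed

end

section \<open>Reading off the normal form\<close>

theorem theorem2p4:
  fixes smul :: "complex \<Rightarrow> 'v::ab_group_add \<Rightarrow> 'v" and bracket :: "'v \<Rightarrow> 'v \<Rightarrow> 'v"
    and n :: nat and \<alpha> :: "nat \<Rightarrow> complex" and e :: "nat \<Rightarrow> 'v" and x :: 'v and \<phi> :: "'v \<Rightarrow> 'v"
  assumes "n \<ge> 4"
    and "s4_algebra smul bracket n \<alpha> e x"
    and "half_derivation smul bracket \<phi>"
  shows "\<exists>(a :: nat \<Rightarrow> complex) (c\<^sub>n :: complex).
    \<phi> (e 1) = smul (a 1) (e 1) + (\<Sum>i = 3..n. smul (a i) (e i)) \<and>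
    (\<forall>i \<in> {2..n}. \<phi> (e i) = smul (a 1) (e i)) \<and>
    \<phi> x = (\<Sum>i = 2..n-1. smul (a (i + 1) + (\<Sum>t = 3..i-1. \<alpha> t * a (i - t + 2))) (e i))
          + smul c\<^sub>n (e n) + smul (a 1) x"
proof -
  interpret s4_algebra smul bracket n \<alpha> e x
    by (rule assms(2))
  have n2: "2 \<le> n"
    using assms(1) by simp
  define a where "a = coord (\<phi> (e 1))"
  define \<psi> where "\<psi> = (\<lambda>u. \<phi> u - smul (a 1) u)"
  have \<phi>: "\<phi> u = smul (a 1) u + \<psi> u" for u
    by (simp add: \<psi>_def)
  have half: "half_derivation smul bracket \<psi>"
    unfolding \<psi>_def by (rule half_derivation_diff_scale[OF assms(3)])
  have \<psi>_e1: "coord (\<psi> (e 1)) k = (if k = 1 then 0 else a k)" if "k \<le> n" for k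
    using that n2 coord_add[of "\<psi> (e 1)" "smul (a 1) (e 1)" k]
    by (auto simp: \<psi>_def coord_scale coord_e unit_coord_def simp flip: a_def)
  have "coord (\<psi> (e 1)) 1 = 0"
    using \<psi>_e1[of 1] n2 by simp
  note normalized = half_derivation_normalized[OF assms(1) half this]
  have a0: "a 0 = 0" and a2: "a 2 = 0"
    using normalized(2,5) \<psi>_e1[of 0] \<psi>_e1[of 2] n2 by auto
  have "\<psi> (e 1) = (\<Sum>i = 2..n. smul (coord (\<psi> (e 1)) i) (e i))"
    using coord_expansion_e[OF n2, of "\<psi> (e 1)"] \<psi>_e1[of 0] \<psi>_e1[of 1] n2 a0 by simp
  also have "\<dots> = (\<Sum>i = 2..n. smul (a i) (e i))"
    by (intro sum.cong) (auto simp: \<psi>_e1)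
  also have "\<dots> = (\<Sum>i = 3..n. smul (a i) (e i))"
  proof (intro sum.mono_neutral_right ballI)
    fix i
    assume "i \<in> {2..n} - {3..n}"
    then have "i = 2"
      by auto
    then show "smul (a i) (e i) = 0"
      by (simp add: a2)
  qed auto
  finally have e1: "\<psi> (e 1) = (\<Sum>i = 3..n. smul (a i) (e i))" .
  have \<psi>_x: "coord (\<psi> x) i = a (i + 1) + (\<Sum>t = 3..i-1. \<alpha> t * a (i - t + 2))"
    if i: "i \<in> {2..n-1}" for i
  proof -
    have Suc_Suc: "Suc (Suc (j - 2)) = j" if "3 \<le> j" for j
      using that by arith
    have "(\<Sum>j = 2..<i. \<alpha> (i + 2 - j) * coord (\<psi> (e 1)) j) = (\<Sum>j = 2..<i. \<alpha> (i + 2 - j) * a j)"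
      using i by (intro sum.cong) (auto simp: \<psi>_e1)
    \<comment> \<open>The term j = 2 drops out because a_2 = 0. The substitution t = i + 2 - j then
      maps 3..i-1 onto itself and reverses the order of summation.\<close>
    also have "\<dots> = (\<Sum>j = 3..<i. \<alpha> (i + 2 - j) * a j)"
    proof (intro sum.mono_neutral_right ballI)
      fix j
      assume "j \<in> {2..<i} - {3..<i}"
      then have "j = 2"
        by auto
      then show "\<alpha> (i + 2 - j) * a j = 0"
        by (simp add: a2)
    qed auto
    also have "\<dots> = (\<Sum>t = 3..i-1. \<alpha> t * a (i - t + 2))"
      by (rule sum.reindex_bij_witness[of _ "\<lambda>t. i + 2 - t" "\<lambda>j. i + 2 - j"])
        (auto simp: Suc_Suc)
    finally show ?thesis
      using normalized(6)[OF i] i \<psi>_e1[of "i + 1"] by (auto simp: s4_ad_x_def One_nat_def)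
  qed
  have "\<psi> x = (\<Sum>i = 2..n. smul (coord (\<psi> x) i) (e i))"
    using coord_expansion_e[OF n2, of "\<psi> x"] normalized(3,4) by simp
  also have "\<dots> = (\<Sum>i = 2..n-1. smul (coord (\<psi> x) i) (e i)) + smul (coord (\<psi> x) n) (e n)"
    using n2 by (cases n) auto
  also have "(\<Sum>i = 2..n-1. smul (coord (\<psi> x) i) (e i))
      = (\<Sum>i = 2..n-1. smul (a (i + 1) + (\<Sum>t = 3..i-1. \<alpha> t * a (i - t + 2))) (e i))"
    by (intro sum.cong) (simp_all only: \<psi>_x)
  \<comment> \<open>The witness for \<open>c\<^sub>n\<close> is coordinate n of
    \<open>\<psi> x\<close>; adding back \<open>a 1\<close> times the identity restores
    \<open>\<phi>\<close>.\<close>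
  finally show ?thesis
    using e1 normalized(1) by (intro exI[of _ a] exI[of _ "coord (\<psi> x) n"]) (simp add: \<phi>)
qed

end
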